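(* Let $\alpha, \beta, \gamma$ be integers and $q(n) = \alpha n^2 + \beta n + \gamma$ for $n \geq 0$, and suppose $D_q(n) = 2^{\lceil \log_2 n \rceil}$ for all $n \geq 1$. Then for every integer $c$, the shifted sequence $q_c(n) = q(n + c)$ ($n \geq 0$) also satisfies $D_{q_c}(n) = 2^{\lceil \log_2 n \rceil}$ for all $n \geq 1$.
   Context: For an integer sequence $s = (s(i))_{i \geq 0}$ and an integer $n \geq 1$, the discriminator $D_s(n)$ is the least positive integer $m$ such that $s(0), \ldots, s(n-1)$ are pairwise incongruent modulo $m$. *)

theory Defs
  imports Complex_Main "HOL-Number_Theory.Cong"
begin

definition discriminates :: "(nat \<Rightarrow> int) \<Rightarrow> nat \<Rightarrow> nat \<Rightarrow> bool" where
  "discriminates s n m \<longleftrightarrow>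
     (\<forall>i<n. \<forall>j<n. i \<noteq> j \<longrightarrow> \<not> [s i = s j] (mod int m))"

text \<open>
  No discriminating modulus exists when two of the first \<open>n\<close> terms coincide; the
  discriminator is then undefined. The value \<open>0\<close> encodes this, so that an equation
  with a positive right-hand side asserts that the discriminator exists.
\<close>

definition discriminator :: "(nat \<Rightarrow> int) \<Rightarrow> nat \<Rightarrow> nat" where
  "discriminator s n =
     (if \<exists>m>0. discriminates s n m then LEAST m. m > 0 \<and> discriminates s n m else 0)"

end

theory Submission
  imports Defs "HOL-Computational_Algebra.Primes"
begin

text \<open>
  The hypothesis on the discriminator is equivalent to an arithmetic condition on the
  coefficients: \<open>\<alpha>\<close> is even, \<open>\<beta>\<close> is odd, and every odd prime dividing \<open>\<alpha>\<close> divides \<open>\<beta>\<close>.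
  A shift by \<open>c\<close> replaces \<open>\<beta>\<close> by \<open>\<beta> + 2 \<alpha> c\<close> and keeps \<open>\<alpha>\<close>, so it preserves this condition.

  Everything rests on \<open>q x - q y = (x - y) (\<alpha> (x + y) + \<beta>)\<close>. Necessity: \<open>n = 2\<close> and
  \<open>n = 3\<close> give the parities, and an odd prime \<open>p\<close> dividing \<open>\<alpha>\<close> but not \<open>\<beta>\<close> would discriminate
  the first \<open>p\<close> terms, although \<open>p\<close> is smaller than the power of two above it. Sufficiency: the
  second factor is odd, so a power of two discriminates as many terms as it can. A modulus \<open>m\<close>
  with \<open>2 ^ k < m < 2 ^ (k + 1)\<close> fails on the arguments \<open>0, \<dots>, 2 ^ k\<close>: if some odd prime \<open>p\<close> divides both
  \<open>m\<close> and \<open>\<alpha>\<close>, then \<open>0\<close> and \<open>m / p\<close> collide; otherwise \<open>m = 2 ^ a r\<close> with \<open>r\<close> odd and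
  prime to \<open>\<alpha>\<close>, and one finds \<open>i < j\<close> with \<open>2 ^ a\<close> dividing \<open>j - i\<close> and \<open>i + j\<close> in the residue class
  modulo \<open>r\<close> that makes the second factor vanish.
\<close>

definition quad :: "int \<Rightarrow> int \<Rightarrow> int \<Rightarrow> int \<Rightarrow> int" where
  "quad \<alpha> \<beta> \<gamma> x = \<alpha> * x\<^sup>2 + \<beta> * x + \<gamma>"

lemma quad_cong_iff:
  "[quad \<alpha> \<beta> \<gamma> x = quad \<alpha> \<beta> \<gamma> y] (mod m) \<longleftrightarrow> m dvd (x - y) * (\<alpha> * (x + y) + \<beta>)"
proof -
  have "quad \<alpha> \<beta> \<gamma> x - quad \<alpha> \<beta> \<gamma> y = (x - y) * (\<alpha> * (x + y) + \<beta>)"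
    by (simp add: quad_def power2_eq_square algebra_simps)
  then show ?thesis by (simp add: cong_iff_dvd_diff)
qed

lemma quad_add:
  "quad \<alpha> \<beta> \<gamma> (x + c) = quad \<alpha> (\<beta> + 2 * \<alpha> * c) (quad \<alpha> \<beta> \<gamma> c) x"
  by (simp add: quad_def power2_eq_square algebra_simps)

lemma discriminator_eqI:
  assumes "m > 0" "discriminates s n m"
    and "\<And>l. 0 < l \<Longrightarrow> l < m \<Longrightarrow> \<not> discriminates s n l"
  shows "discriminator s n = m"
proof -
  have "(LEAST m. m > 0 \<and> discriminates s n m) = m"
    using assms by (intro Least_equality) (auto simp: not_less[symmetric])
  then show ?thesis using assms(1,2) by (auto simp: discriminator_def)
qed

text \<open>Positivity rules out the default value \<open>0\<close>, so the minimum is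
  attained.\<close>

lemma discriminates_discriminator:
  assumes "discriminator s n > 0"
  shows "discriminates s n (discriminator s n)"
proof -
  from assms have ex: "\<exists>m. m > 0 \<and> discriminates s n m"
    by (auto simp: discriminator_def split: if_splits)
  then show ?thesis using LeastI_ex[OF ex] by (simp add: discriminator_def)
qed

lemma discriminator_le:
  assumes "m > 0" "discriminates s n m"
  shows "discriminator s n \<le> m"
  using assms by (auto simp: discriminator_def intro: Least_le)

lemma le_two_power_ceiling_log:
  assumes "n \<ge> 1"
  shows "n \<le> 2 ^ nat \<lceil>log 2 (real n)\<rceil>"
proof -
  have "log 2 (real n) \<le> real (nat \<lceil>log 2 (real n)\<rceil>)" by linarith
  then have "real n \<le> 2 powr real (nat \<lceil>log 2 (real n)\<rceil>)"
    using assms by (subst (asm) log_le_iff) simp_all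
  then have "real n \<le> 2 ^ nat \<lceil>log 2 (real n)\<rceil>"
    by (simp add: powr_realpow)
  then show ?thesis by (metis of_nat_le_iff of_nat_numeral of_nat_power)
qed

lemma two_power_less_of_Suc_eq_ceiling_log:
  assumes "n \<ge> 1" "nat \<lceil>log 2 (real n)\<rceil> = Suc k"
  shows "2 ^ k < n"
proof -
  \<comment> \<open>The value \<open>Suc k\<close> is positive, so \<open>nat\<close> has not
    truncated the ceiling.\<close>
  have "real k < log 2 (real n)" using assms(2) by linarith
  then have "2 ^ k < real n"
    using assms(1) by (simp add: less_log_iff powr_realpow)
  then show ?thesis by (metis of_nat_less_iff of_nat_numeral of_nat_power)
qed

lemma discriminates_quad_two_power:
  assumes "even \<alpha>" "odd \<beta>" "n \<le> 2 ^ K"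
  shows "discriminates (\<lambda>i. quad \<alpha> \<beta> \<gamma> (int i)) n (2 ^ K)"
  unfolding discriminates_def
proof (intro allI impI notI)
  fix i j assume ij: "i < n" "j < n" "i \<noteq> j"
    and "[quad \<alpha> \<beta> \<gamma> (int i) = quad \<alpha> \<beta> \<gamma> (int j)] (mod int (2 ^ K))"
  then have d: "2 ^ K dvd (int i - int j) * (\<alpha> * (int i + int j) + \<beta>)"
    by (simp add: quad_cong_iff)
  have "coprime (2 ^ K) (\<alpha> * (int i + int j) + \<beta>)" using assms(1,2) by simp
  with d have "2 ^ K dvd int i - int j" by (simp add: coprime_dvd_mult_left_iff)
  then have "2 ^ K \<le> \<bar>int i - int j\<bar>" using ij dvd_imp_le_int[of "int i - int j"] by force
  moreover have "\<bar>int i - int j\<bar> < int n" using ij by linarith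
  moreover have "int n \<le> 2 ^ K" using assms(3) by (metis of_nat_le_iff of_nat_numeral of_nat_power)
  ultimately show False by linarith
qed

lemma quad_collision_coprime:
  fixes \<alpha> \<beta> :: int and a r k :: nat
  assumes "odd r" "r \<ge> 3" "coprime \<alpha> (int r)" and less: "2 ^ a * r < 2 ^ Suc k"
  obtains i j :: nat where "i < j" "j \<le> 2 ^ k"
    "int (2 ^ a * r) dvd (int i - int j) * (\<alpha> * (int i + int j) + \<beta>)"
proof -
  from cong_solve_coprime_int[OF assms(3)] obtain x where x: "[\<alpha> * x = 1] (mod int r)"
    by auto
  \<comment> \<open>As \<open>x\<close> inverts \<alpha> modulo \<open>r\<close>, this is the root
    of \<alpha> y + \<beta> modulo \<open>r\<close>.\<close>
  define t where "t = - \<beta> * x"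
  have root: "int r dvd \<alpha> * y + \<beta>" if "int r dvd y - t" for y
  proof -
    have "\<alpha> * y + \<beta> = \<alpha> * (y - t) - \<beta> * (\<alpha> * x - 1)"
      by (simp add: t_def algebra_simps)
    moreover have "int r dvd \<alpha> * x - 1" using x by (simp add: cong_iff_dvd_diff)
    ultimately show ?thesis using that by simp
  qed
  show thesis
  proof (cases a)
    case 0
    \<comment> \<open>With \<open>a = 0\<close> the difference is unconstrained. Shifting by 1 picks
      the representative of \<open>t\<close> in 1..r rather than 0..r-1, because 0 is not a sum
      \<open>i + j\<close> with \<open>i < j\<close>.\<close>
    define S where "S = nat ((t - 1) mod int r) + 1"
    have S: "1 \<le> S" "S \<le> r"
      using assms(2) pos_mod_bound[of "int r" "t - 1"] by (simp_all add: S_def, linarith)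
    have "int S - t = (t - 1) mod int r - (t - 1)" using assms(2) by (simp add: S_def)
    then have St: "int r dvd int S - t"
      by (metis mod_eq_dvd_iff mod_mod_trivial)
    define j where "j = S div 2 + 1"
    define i where "i = S - j"
    have "i < j" "i + j = S" using S by (auto simp: i_def j_def)
    moreover have "j \<le> 2 ^ k" using S less 0 by (simp add: j_def)
    moreover from this have "int r dvd \<alpha> * (int i + int j) + \<beta>"
      using root[OF St] \<open>i + j = S\<close> by (metis of_nat_add)
    ultimately show ?thesis using that[of i j] 0 by simp
  next
    case (Suc b)
    from assms(1) obtain h where h: "r = 2 * h + 1" by (auto elim: oddE)
    \<comment> \<open>\<open>h + 1\<close> is the inverse of 2 modulo \<open>r\<close>, so \<open>i\<close> solves \<open>2 i + 2 ^ a = t\<close> there.\<close>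
    define u where "u = (t - 2 ^ a) * (int h + 1)"
    define i where "i = nat (u mod int r)"
    have i: "int i = u mod int r" "i < r"
      using assms(2) pos_mod_bound[of "int r" u] by (simp_all add: i_def nat_less_iff)
    have "int r dvd int i - u" using i(1) by (simp add: mod_eq_dvd_iff[symmetric])
    moreover have "2 * int i + 2 ^ a - t = 2 * (int i - u) + int r * (t - 2 ^ a)"
      by (simp add: u_def h algebra_simps)
    ultimately have "int r dvd 2 * int i + 2 ^ a - t" by (metis dvd_add dvd_mult dvd_triv_left)
    from root[OF this] have "int r dvd \<alpha> * (int i + int (i + 2 ^ a)) + \<beta>"
      by (simp add: algebra_simps)
    then have "int (2 ^ a * r) dvd (int i - int (i + 2 ^ a)) * (\<alpha> * (int i + int (i + 2 ^ a)) + \<beta>)"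
      by (simp add: mult_dvd_mono)
    moreover have "i + 2 ^ a \<le> 2 ^ k"
    proof -
      \<comment> \<open>Since \<open>i \<le> r - 1\<close> and
        \<open>2 ^ b * r + 1 \<le> 2 ^ k\<close>, the bound follows from
        \<open>r + 2 * 2 ^ b \<le> 2 ^ b * r + 2\<close>, which is this product expanded.\<close>
      have "(0::int) \<le> (2 ^ b - 1) * (int r - 2)" using assms(2) by simp
      then have "int r + 2 * 2 ^ b \<le> 2 ^ b * int r + 2" by (simp add: algebra_simps)
      then have "r + 2 * 2 ^ b \<le> 2 ^ b * r + 2" by (simp flip: of_nat_le_iff[where ?'a = int])
      moreover have "2 ^ b * r < 2 ^ k" using less Suc by simp
      ultimately show ?thesis using i(2) Suc by simp
    qed
    ultimately show ?thesis using that[of i "i + 2 ^ a"] by simp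
  qed
qed

lemma quad_collision:
  fixes \<alpha> \<beta> :: int and m k :: nat
  assumes primes: "\<And>p. prime p \<Longrightarrow> odd p \<Longrightarrow> p dvd \<alpha> \<Longrightarrow> p dvd \<beta>"
    and m: "2 ^ k < m" "m < 2 ^ Suc k"
  obtains i j :: nat where "i < j" "j \<le> 2 ^ k"
    "int m dvd (int i - int j) * (\<alpha> * (int i + int j) + \<beta>)"
proof (cases "\<exists>p. prime p \<and> odd p \<and> p dvd int m \<and> p dvd \<alpha>")
  case True
  then obtain p where p: "prime p" "odd p" "p dvd int m" "p dvd \<alpha>" by blast
  have "p \<ge> 3" using p(1,2) prime_ge_2_int[of p] by (cases "p = 2") auto
  obtain l where l: "int m = p * l" using p(3) by blast
  have "0 < p * l" using l m(1) by simp
  then have "l > 0" using \<open>p \<ge> 3\<close> by (simp add: zero_less_mult_iff)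
  then have "3 * l \<le> int m" using l \<open>p \<ge> 3\<close> by (simp add: mult_right_mono)
  moreover have "int m < 2 * 2 ^ k"
    using m(2) by (metis of_nat_less_iff of_nat_numeral of_nat_power power_Suc)
  ultimately have "l < 2 ^ k" by linarith
  \<comment> \<open>The first factor supplies \<open>l\<close>; the second supplies
    \<open>p\<close>, which divides both coefficients.\<close>
  moreover have "int m dvd (0 - l) * (\<alpha> * (0 + l) + \<beta>)"
    unfolding l mult.commute[of p] using p primes by (intro mult_dvd_mono) auto
  ultimately show ?thesis using that[of 0 "nat l"] \<open>l > 0\<close> by (simp add: nat_le_iff)
next
  case False
  have "m \<noteq> 0" using m(1) by auto
  then obtain r where "m = 2 ^ multiplicity 2 m * r" "odd r"
    by (rule multiplicity_decompose'[where p = 2]) (simp_all only: odd_one not_False_eq_True)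
  then obtain a where r: "m = 2 ^ a * r" "odd r" by blast
  \<comment> \<open>No power of two lies strictly between \<open>2 ^ k\<close> and
    \<open>2 ^ Suc k\<close>.\<close>
  have "r \<noteq> 1"
  proof
    assume "r = 1"
    then have "k < a" "a < Suc k" using m r(1) by (simp_all del: power_Suc)
    then show False by simp
  qed
  with r(2) have "r \<ge> 3" by (cases "r = 2"; cases "r = 0") auto
  have "coprime \<alpha> (int r)"
  proof (rule ccontr)
    assume "\<not> coprime \<alpha> (int r)"
    then have "\<not> is_unit (gcd \<alpha> (int r))" by (simp only: is_unit_gcd not_False_eq_True)
    moreover have "gcd \<alpha> (int r) \<noteq> 0" using \<open>r \<ge> 3\<close> by simp
    ultimately obtain p where "prime p" "p dvd gcd \<alpha> (int r)"
      using prime_divisor_exists by blast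
    then have p: "prime p" "p dvd \<alpha>" "p dvd int r" by simp_all
    moreover have "odd p" using p(3) r(2) by (metis dvd_trans even_of_nat)
    moreover have "p dvd int m" using p(3) by (simp add: r(1))
    ultimately show False using False by blast
  qed
  from quad_collision_coprime[OF r(2) \<open>r \<ge> 3\<close> this] m(2) r(1) that show ?thesis by metis
qed

theorem discriminator_quad_two_power_iff:
  "(\<forall>n\<ge>1. discriminator (\<lambda>i. quad \<alpha> \<beta> \<gamma> (int i)) n = 2 ^ nat \<lceil>log 2 (real n)\<rceil>) \<longleftrightarrow>
   even \<alpha> \<and> odd \<beta> \<and> (\<forall>p. prime p \<longrightarrow> odd p \<longrightarrow> p dvd \<alpha> \<longrightarrow> p dvd \<beta>)"
  (is "?L \<longleftrightarrow> ?R")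
proof
  let ?s = "\<lambda>i. quad \<alpha> \<beta> \<gamma> (int i)"
  assume L: ?L
  have disc: "discriminates ?s n (2 ^ nat \<lceil>log 2 (real n)\<rceil>)" if "n \<ge> 1" for n
    using discriminates_discriminator[of ?s n] L that by simp
  have "\<lceil>log 2 3\<rceil> = 2"
    by (rule ceiling_unique) (simp_all add: less_log_iff log_le_iff)
  then have "discriminates ?s 2 2" "discriminates ?s 3 4"
    using disc[of 2] disc[of 3] by simp_all
  \<comment> \<open>Arguments 1 and 0 modulo 2 make \<alpha> + \<beta> odd; 2 and 0 modulo 4 make 2
    \<alpha> + \<beta> odd, hence \<beta>.\<close>
  from this(1)[unfolded discriminates_def, rule_format, of 1 0]
    this(2)[unfolded discriminates_def, rule_format, of 2 0]
  have "\<not> [?s 1 = ?s 0] (mod 2)" "\<not> [?s 2 = ?s 0] (mod 4)"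
    by simp_all
  then have par: "odd (\<alpha> + \<beta>)" "\<not> 2 * 2 dvd 2 * (\<alpha> * 2 + \<beta>)"
    by (simp_all add: quad_cong_iff)
  from par(2) have "odd \<beta>" by (subst (asm) dvd_mult_cancel_left) simp
  moreover from this par(1) have "even \<alpha>" by simp
  moreover have "p dvd \<beta>" if p: "prime p" "odd p" "p dvd \<alpha>" for p
  proof (rule ccontr)
    assume nd: "\<not> p dvd \<beta>"
    define P where "P = nat p"
    have P: "int P = p" "P \<ge> 2" using prime_ge_2_int[OF p(1)] by (auto simp: P_def)
    have "discriminates ?s P P"
      unfolding discriminates_def
    proof (intro allI impI notI)
      fix i j assume ij: "i < P" "j < P" "i \<noteq> j" and "[?s i = ?s j] (mod int P)"
      then have "p dvd (int i - int j) * (\<alpha> * (int i + int j) + \<beta>)"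
        by (simp add: quad_cong_iff P)
      moreover have "\<not> p dvd \<alpha> * (int i + int j) + \<beta>"
        using p(3) nd by (simp add: dvd_add_right_iff)
      ultimately have "p dvd int i - int j" using p(1) prime_dvd_mult_iff by blast
      then have "p \<le> \<bar>int i - int j\<bar>" using ij dvd_imp_le_int[of "int i - int j"] by force
      then show False using ij P(1) by linarith
    qed
    then have "2 ^ nat \<lceil>log 2 (real P)\<rceil> \<le> P" using discriminator_le[of P ?s P] L P(2) by simp
    then have pow: "P = 2 ^ nat \<lceil>log 2 (real P)\<rceil>"
      using le_two_power_ceiling_log[of P] P(2) by linarith
    have "odd P" using p(2) P(1) by (metis even_of_nat)
    \<comment> \<open>The only odd power of two is 1, which \<open>P \<ge> 2\<close>
      excludes.\<close>
    with pow have "nat \<lceil>log 2 (real P)\<rceil> = 0" by (metis even_numeral even_power gr0I)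
    with pow P(2) show False by simp
  qed
  ultimately show ?R by blast
next
  let ?s = "\<lambda>i. quad \<alpha> \<beta> \<gamma> (int i)"
  assume R: ?R
  show ?L
  proof (intro allI impI)
    fix n :: nat assume n: "n \<ge> 1"
    define K where "K = nat \<lceil>log 2 (real n)\<rceil>"
    show "discriminator ?s n = 2 ^ nat \<lceil>log 2 (real n)\<rceil>"
      unfolding K_def[symmetric]
    proof (rule discriminator_eqI)
      show "discriminates ?s n (2 ^ K)"
        using R le_two_power_ceiling_log[OF n] by (intro discriminates_quad_two_power) (auto simp: K_def)
    next
      fix m :: nat assume m: "0 < m" "m < 2 ^ K"
      then obtain k where k: "K = Suc k" by (cases K) auto
      have kn: "2 ^ k < n" using two_power_less_of_Suc_eq_ceiling_log[OF n] k by (simp add: K_def)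
      have "\<exists>i j. i < j \<and> j \<le> 2 ^ k \<and> int m dvd (int i - int j) * (\<alpha> * (int i + int j) + \<beta>)"
      proof (cases "m \<le> 2 ^ k")
        case True
        \<comment> \<open>For so small a modulus the arguments 0 and \<open>m\<close> already
          collide.\<close>
        then show ?thesis using m(1) by (intro exI[of _ 0] exI[of _ m]) simp
      next
        case False
        with quad_collision[of \<alpha> \<beta> k m] R m(2) k show ?thesis by (metis not_le)
      qed
      then obtain i j where ij: "i < j" "j \<le> 2 ^ k"
        "int m dvd (int i - int j) * (\<alpha> * (int i + int j) + \<beta>)"
        by blast
      then have "i < n" "j < n" "i \<noteq> j" using kn by auto
      with ij(3) show "\<not> discriminates ?s n m"
        unfolding discriminates_def quad_cong_iff by blast
    qed simp
  qed
qed

theorem theorem8: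
  fixes \<alpha> \<beta> \<gamma> :: int and q :: "int \<Rightarrow> int"
  assumes q_def: "\<And>x. q x = \<alpha> * x\<^sup>2 + \<beta> * x + \<gamma>"
    and disc: "\<And>n::nat. n \<ge> 1 \<Longrightarrow>
      discriminator (\<lambda>i. q (int i)) n = 2 ^ nat \<lceil>log 2 (real n)\<rceil>"
  shows "\<forall>c::int. \<forall>n::nat. n \<ge> 1 \<longrightarrow>
      discriminator (\<lambda>i. q (int i + c)) n = 2 ^ nat \<lceil>log 2 (real n)\<rceil>"
proof
  fix c :: int
  have q: "q = quad \<alpha> \<beta> \<gamma>" by (rule ext) (simp add: q_def quad_def)
  have "even \<alpha> \<and> odd \<beta> \<and> (\<forall>p. prime p \<longrightarrow> odd p \<longrightarrow> p dvd \<alpha> \<longrightarrow> p dvd \<beta>)"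
    using disc unfolding q discriminator_quad_two_power_iff[of \<alpha> \<beta> \<gamma>, symmetric] by blast
  then show "\<forall>n::nat. n \<ge> 1 \<longrightarrow>
      discriminator (\<lambda>i. q (int i + c)) n = 2 ^ nat \<lceil>log 2 (real n)\<rceil>"
    \<comment> \<open>The linear coefficient changes by a multiple of 2 \<alpha>, so its parity and
      its divisibility by primes dividing \<alpha> are unchanged.\<close>
    unfolding q quad_add discriminator_quad_two_power_iff by simp
qed

end
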